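(* Let $D$ be a discrete topological space with $|D| = \aleph_1$. Let $\operatorname{Met}(D)$ be the set of all metrics on $D$ that induce the discrete topology on $D$, equipped with the topology induced by the supremum distance $\rho(d,d') = \sup_{x,y\in D} |d(x,y)-d'(x,y)|$. Then $\operatorname{Met}(D)$ is not completely metrizable.
   Context: The result is stated in ZFC (no continuum hypothesis is assumed). For a discrete space $D$, $\operatorname{Met}(D)$ denotes the set of metrics $d\colon D\times D\to[0,\infty)$ whose induced topology is the discrete topology on $D$ (equivalently, $\inf_{v\neq u} d(u,v)>0$ for every $u\in D$, the bound being allowed to depend on $u$). Metrics in $\operatorname{Met}(D)$ may be unbounded, so $\rho(d,d')=\sup_{x,y\in D}|d(x,y)-d'(x,y)|\in[0,+\infty]$ is an extended metric; its topology is the one induced by the ordinary metric $\min(\rho,1)$. A topological space is completely metrizable if it is homeomorphic to a complete metric space (separability is not required). *)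

theory Defs
  imports "HOL-Analysis.Analysis"
begin

unbundle cardinal_syntax

text \<open>
  The metrics on the underlying set of \<open>X\<close> that induce the topology of \<open>X\<close>.
  Functions are total, so the last condition fixes the irrelevant values off
  \<open>topspace X \<times> topspace X\<close>; a metric on that set is then represented by exactly one
  element. The value has to be \<open>0\<close>, since \<open>Metric_space\<close> requires nonnegativity and
  symmetry for all arguments.
\<close>

definition Met :: "'a topology \<Rightarrow> ('a \<Rightarrow> 'a \<Rightarrow> real) set" where
  "Met X = {d. Metric_space (topspace X) d \<and>
               Metric_space.mtopology (topspace X) d = X \<and>
               (\<forall>x y. x \<notin> topspace X \<or> y \<notin> topspace X \<longrightarrow> d x y = 0)}"

definition sup_dist :: "'a set \<Rightarrow> ('a \<Rightarrow> 'a \<Rightarrow> real) \<Rightarrow> ('a \<Rightarrow> 'a \<Rightarrow> real) \<Rightarrow> ennreal" where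
  "sup_dist D d d' = (SUP (x, y) \<in> D \<times> D. ennreal \<bar>d x y - d' x y\<bar>)"

definition Met_topology :: "'a topology \<Rightarrow> ('a \<Rightarrow> 'a \<Rightarrow> real) topology" where
  "Met_topology X =
     Metric_space.mtopology (Met X) (\<lambda>d d'. enn2real (min (sup_dist (topspace X) d d') 1))"

text \<open>
  The library defines \<open>Metric_space.mtopology\<close> for an arbitrary function;
  \<open>Metric_space_Met\<close> below shows that it is applied to a genuine metric here.
\<close>

lemma sup_dist_commute: "sup_dist D d d' = sup_dist D d' d"
  by (simp add: sup_dist_def abs_minus_commute)

lemma sup_dist_upper:
  "x \<in> D \<Longrightarrow> y \<in> D \<Longrightarrow> ennreal \<bar>d x y - d' x y\<bar> \<le> sup_dist D d d'"
  unfolding sup_dist_def by (rule SUP_upper2[of "(x, y)"]) auto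

lemma sup_dist_triangle: "sup_dist D d d'' \<le> sup_dist D d d' + sup_dist D d' d''"
proof -
  have "ennreal \<bar>d x y - d'' x y\<bar> \<le> sup_dist D d d' + sup_dist D d' d''"
    if "x \<in> D" "y \<in> D" for x y
  proof -
    have "ennreal \<bar>d x y - d'' x y\<bar> \<le> ennreal (\<bar>d x y - d' x y\<bar> + \<bar>d' x y - d'' x y\<bar>)"
      by (rule ennreal_leI) simp
    also have "\<dots> = ennreal \<bar>d x y - d' x y\<bar> + ennreal \<bar>d' x y - d'' x y\<bar>"
      by simp
    also have "\<dots> \<le> sup_dist D d d' + sup_dist D d' d''"
      using that by (intro add_mono sup_dist_upper)
    finally show ?thesis .
  qed
  then show ?thesis
    by (subst sup_dist_def) (auto intro!: SUP_least)
qed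

lemma Metric_space_Met:
  "Metric_space (Met X) (\<lambda>d d'. enn2real (min (sup_dist (topspace X) d d') 1))"
proof
  let ?D = "topspace X"
  fix d d' d'' :: "'a \<Rightarrow> 'a \<Rightarrow> real"
  have fin: "min a 1 < (top::ennreal)" for a
    by (simp add: min_less_iff_disj)
  show "0 \<le> enn2real (min (sup_dist ?D d d') 1)"
    by simp
  show "enn2real (min (sup_dist ?D d d') 1) = enn2real (min (sup_dist ?D d' d) 1)"
    by (simp add: sup_dist_commute)
  show "enn2real (min (sup_dist ?D d d') 1) = 0 \<longleftrightarrow> d = d'"
    if dd: "d \<in> Met X" "d' \<in> Met X"
  proof
    assume "enn2real (min (sup_dist ?D d d') 1) = 0"
    then have "min (sup_dist ?D d d') 1 = 0"
      using fin[of "sup_dist ?D d d'"] by (auto simp: enn2real_eq_0_iff)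
    then have 0: "sup_dist ?D d d' = 0"
      by (auto simp: min_def split: if_splits)
    show "d = d'"
    proof (intro ext)
      fix x y
      show "d x y = d' x y"
      proof (cases "x \<in> ?D \<and> y \<in> ?D")
        case True
        then have "ennreal \<bar>d x y - d' x y\<bar> \<le> 0"
          using sup_dist_upper[of x ?D y d d'] 0 by simp
        then show ?thesis
          by simp
      next
        case False
        then show ?thesis
          using dd by (auto simp: Met_def)
      qed
    qed
  next
    assume "d = d'"
    then have "sup_dist ?D d d' \<le> 0"
      unfolding sup_dist_def by (intro SUP_least) auto
    then show "enn2real (min (sup_dist ?D d d') 1) = 0"
      by simp
  qed
  show "enn2real (min (sup_dist ?D d d'') 1)
      \<le> enn2real (min (sup_dist ?D d d') 1) + enn2real (min (sup_dist ?D d' d'') 1)"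
  proof -
    have "min c 1 \<le> min a 1 + min b 1" if "c \<le> a + b" for a b c :: ennreal
    proof (cases "a \<le> 1 \<and> b \<le> 1")
      case True
      then show ?thesis
        using that by (auto simp: min_def intro: order.trans[OF _ that] dest: le_cases)
    next
      case False
      then have "1 \<le> min a 1 + min b 1"
        by (auto simp: min_def add_increasing add_increasing2)
      then show ?thesis
        using min.coboundedI2 by blast
    qed
    from this[OF sup_dist_triangle]
    have "enn2real (min (sup_dist ?D d d'') 1)
        \<le> enn2real (min (sup_dist ?D d d') 1 + min (sup_dist ?D d' d'') 1)"
      using fin by (intro enn2real_mono) auto
    also have "\<dots> = enn2real (min (sup_dist ?D d d') 1) + enn2real (min (sup_dist ?D d' d'') 1)"
      using fin by (intro enn2real_plus) auto
    finally show ?thesis .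
  qed
qed

end

theory Submission
  imports Defs "HOL-Library.Countable_Set_Type"
begin

text \<open>
  The condition that a metric be discrete is an intersection of open conditions, one for each point
  of \<open>D\<close>. For uncountable \<open>D\<close> this intersection need not be a \<open>G\<^sub>\<delta>\<close> set, and the proof shows that
  it is not one when \<open>D\<close> has cardinality \<open>\<aleph>\<^sub>1\<close>, by pulling it back to a complete parameter space.

  Well-order \<open>D\<close> in type \<open>\<omega>\<^sub>1\<close>, let \<open>V a\<close> be the set of predecessors of \<open>a\<close>, and let \<open>c\<close> be an injection
  of \<open>D\<close> into the reals. A parameter \<open>z = (x, y)\<close> consists of a sequence \<open>x\<close> in the discrete space \<open>D\<close>
  and a real \<open>y\<close>. Let \<open>w z a\<close> measure the distance of \<open>z\<close> from \<open>B a = (V a)\<^sup>\<omega> \<times> {c a}\<close>, and give distinct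
  points \<open>a\<close>, \<open>b\<close> the distance \<open>max (w z a) (w z b)\<close>. This is a discrete metric if \<open>z\<close> lies in no \<open>B a\<close>,
  and for all but countably many \<open>a\<close> it is not one if \<open>z\<close> lies in \<open>B a\<close>. As the weights are
  equicontinuous, complete metrizability of the space of metrics would make the set of good parameters a
  \<open>G\<^sub>\<delta>\<close> set (lemma \<open>gdelta_in_preimage_Met\<close>), so the degenerate parameters would be a union of
  closed sets \<open>F n\<close>.

  By Baire's theorem each such nonempty \<open>B a\<close> has a nonempty relatively open piece in some \<open>F n\<close>, described by \<open>n\<close>
  and a finite sequence \<open>s\<close> in \<open>V a\<close> (lemma \<open>cylinder_in_cover\<close>). Pressing down yields one pair \<open>(n, s)\<close>
  for uncountably many \<open>a\<close>. Among these choose \<open>b\<close> such that \<open>c b\<close> is a limit of uncountably many of the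
  corresponding \<open>c a\<close>, and let \<open>x\<close> be \<open>s\<close> followed by \<open>b\<close> repeated forever. Then \<open>x\<close> lies in \<open>V a\<close> for all
  but countably many \<open>a\<close>, so \<open>(x, c b)\<close> is a limit of points \<open>(x, c a)\<close> in \<open>F n\<close> and is degenerate.
  But \<open>c\<close> is injective and \<open>x\<close> leaves \<open>V b\<close>, so \<open>(x, c b)\<close> lies in no \<open>B a\<close>: a contradiction.
\<close>

section \<open>Segments of type \<open>\<omega>\<^sub>1\<close> and pressing down\<close>

text \<open>
  Abstracts a well-order of type \<open>\<omega>\<^sub>1\<close> on \<open>D\<close>: \<open>V a\<close> is the set of strict predecessors of \<open>a\<close>.
  The order is encoded by its segments because the proof speaks of sequences that stay inside one.
\<close>

locale omega1_segments =
  fixes D :: "'a set" and V :: "'a \<Rightarrow> 'a set"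
  assumes uncountable_D: "uncountable D"
    and V_subset: "a \<in> D \<Longrightarrow> V a \<subseteq> D"
    and V_irrefl: "a \<notin> V a"
    and V_total: "a \<in> D \<Longrightarrow> b \<in> D \<Longrightarrow> a \<noteq> b \<Longrightarrow> a \<in> V b \<or> b \<in> V a"
    and V_trans: "a \<in> V b \<Longrightarrow> V a \<subseteq> V b"
    and countable_V: "a \<in> D \<Longrightarrow> countable (V a)"
    and V_wf: "S \<subseteq> D \<Longrightarrow> S \<noteq> {} \<Longrightarrow> \<exists>a\<in>S. V a \<inter> S = {}"

text \<open>
  The cardinal \<open>|D|\<close> is itself a well-order of \<open>D\<close> whose proper segments have smaller cardinality,
  hence are countable.
\<close>

lemma aleph1_omega1_segments:
  assumes "|D| =o cardSuc natLeq"
  obtains V where "omega1_segments D V"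
proof
  let ?r = "|D|"
  have wo: "well_order_on D ?r" and F: "Field ?r = D"
    by (simp_all add: card_of_well_order_on Field_card_of)
  then have lin: "Linear_order ?r" and wf: "wf (?r - Id)"
    by (auto simp: well_order_on_def)
  then have r: "trans ?r" "antisym ?r" "total_on D ?r"
    using F by (auto simp: order_on_defs)
  show "omega1_segments D (underS ?r)"
  proof
    have "natLeq <o ?r"
      using assms cardSuc_greater[OF natLeq_Card_order] ordIso_symmetric ordLess_ordIso_trans by blast
    then show "uncountable D"
      by (simp add: countable_card_le_natLeq not_ordLess_ordLeq)
    fix a b
    show "a \<in> D \<Longrightarrow> underS ?r a \<subseteq> D"
      using F by (auto simp: underS_def Field_def)
    show "a \<notin> underS ?r a"
      by (simp add: underS_def)
    show "a \<in> D \<Longrightarrow> b \<in> D \<Longrightarrow> a \<noteq> b \<Longrightarrow> a \<in> underS ?r b \<or> b \<in> underS ?r a"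
      using r(3) by (auto simp: underS_def total_on_def)
    show "a \<in> underS ?r b \<Longrightarrow> underS ?r a \<subseteq> underS ?r b"
      using r(1,2) by (auto simp: underS_def dest: transD antisymD)
    show "countable (underS ?r a)" if "a \<in> D"
    proof -
      have "|underS ?r a| <o ?r"
        using that F by (intro card_of_underS card_of_Card_order) simp
      then have "|underS ?r a| <o cardSuc natLeq"
        using assms ordLess_ordIso_trans by blast
      then show ?thesis
        unfolding countable_card_le_natLeq
        using cardSuc_ordLeq_ordLess[OF natLeq_Card_order card_of_Card_order] by blast
    qed
    show "\<exists>a\<in>S. underS ?r a \<inter> S = {}" if "S \<subseteq> D" "S \<noteq> {}" for S
    proof -
      obtain x where "x \<in> S" using \<open>S \<noteq> {}\<close> by blast
      then obtain z where "z \<in> S" "\<And>y. (y, z) \<in> ?r - Id \<Longrightarrow> y \<notin> S"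
        using wfE_min[OF wf] by metis
      then show ?thesis by (auto simp: underS_def)
    qed
  qed
qed

context omega1_segments
begin

lemma countable_not_above:
  assumes "b \<in> D"
  shows "countable {a \<in> D. b \<notin> V a}"
proof (rule countable_subset)
  show "{a \<in> D. b \<notin> V a} \<subseteq> insert b (V b)"
    using V_total assms by blast
qed (use assms countable_V in auto)

text \<open>
  The least element outside \<open>C\<close> exists because \<open>D\<close> is uncountable, and its segment is \<open>C\<close>.
  This is how a closing-off argument ends in a single point of \<open>D\<close>.
\<close>

lemma countable_closed_is_segment:
  assumes "C \<subseteq> D" "countable C" and down: "\<And>a. a \<in> C \<Longrightarrow> V a \<subseteq> C"
  obtains a where "a \<in> D" "V a = C"
proof -
  have "D - C \<noteq> {}"
    using assms(2) uncountable_D by (metis Diff_eq_empty_iff countable_subset)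
  then obtain a where a: "a \<in> D - C" "V a \<inter> (D - C) = {}"
    using V_wf[of "D - C"] by blast
  have "V a = C"
  proof
    show "V a \<subseteq> C"
      using a V_subset by blast
    show "C \<subseteq> V a"
      using a down V_total assms(1) by blast
  qed
  with a that show thesis by blast
qed

text \<open>
  A weak form of Fodor's lemma: a function that sends all but countably
  many \<open>a\<close> to a natural number and a finite
  sequence of predecessors of \<open>a\<close> has an uncountable fibre. If every fibre were countable, close a
  countable set off under passing from a value to all points that have it. The closure is a segment
  \<open>V d\<close>; the value at \<open>d\<close> is built from members of \<open>V d\<close>, so closure puts \<open>d\<close> itself into \<open>V d\<close>.
\<close>

lemma pressing_down:
  fixes g :: "'a \<Rightarrow> nat \<times> 'a list"
  assumes g: "\<And>a. a \<in> E \<Longrightarrow> set (snd (g a)) \<subseteq> V a"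
    and E: "E \<subseteq> D" "countable (D - E)"
  obtains p where "uncountable {a \<in> E. g a = p}"
proof (rule ccontr)
  assume "\<not> thesis"
  with that have fib: "countable {a \<in> E. g a = p}" for p by blast
  define grow where "grow S = S \<union> (\<Union>p\<in>UNIV \<times> lists S. \<Union>a\<in>{a \<in> E. g a = p}. insert a (V a))" for S
  \<comment> \<open>Starting with the points outside \<open>E\<close> forces the final point \<open>d\<close> to lie in \<open>E\<close>.\<close>
  define C0 where "C0 = (\<Union>a\<in>D - E. insert a (V a))"
  define C where "C k = (grow ^^ k) C0" for k
  have C_Suc: "C (Suc k) = grow (C k)" for k
    by (simp add: C_def)
  have C: "C k \<subseteq> D \<and> countable (C k) \<and> (\<forall>a\<in>C k. V a \<subseteq> C k)" for k
  proof (induction k)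
    case 0
    have "C0 \<subseteq> D" "countable C0"
      using E V_subset countable_V unfolding C0_def by auto
    moreover have "\<forall>a\<in>C0. V a \<subseteq> C0"
      using V_trans unfolding C0_def by blast
    ultimately show ?case by (simp add: C_def)
  next
    case (Suc k)
    have "grow (C k) \<subseteq> D"
      using Suc E V_subset unfolding grow_def by blast
    moreover have "\<forall>a\<in>grow (C k). V a \<subseteq> grow (C k)"
      using Suc V_trans unfolding grow_def by blast
    moreover have "countable (grow (C k))"
    proof -
      have 1: "countable ((UNIV :: nat set) \<times> lists (C k))"
        using Suc by (intro countable_SIGMA countable_lists) auto
      have 2: "countable (\<Union>a\<in>{a \<in> E. g a = p}. insert a (V a))" for p
        using E countable_V by (intro countable_UN fib) auto
      show ?thesis
        unfolding grow_def using Suc by (intro countable_Un[OF _ countable_UN[OF 1 2]]) simp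
    qed
    ultimately show ?case by (simp add: C_Suc)
  qed
  have mono: "C j \<subseteq> C k" if "j \<le> k" for j k
    using that by (rule lift_Suc_mono_le[of C, rotated]) (auto simp: C_Suc grow_def)
  obtain d where d: "d \<in> D" "V d = (\<Union>k. C k)"
    by (rule countable_closed_is_segment[of "\<Union>k. C k"]) (use C in blast)+
  have "C0 \<subseteq> V d"
  proof -
    have "C 0 = C0" by (simp add: C_def)
    then show ?thesis using d by blast
  qed
  then have "d \<in> E"
    using V_irrefl[of d] d by (auto simp: C0_def)
  have "\<exists>k. set s \<subseteq> C k" if "set s \<subseteq> (\<Union>k. C k)" for s
    using that
  proof (induction s)
    case (Cons x s)
    then obtain j k where "x \<in> C j" "set s \<subseteq> C k" by auto
    then show ?case
      using mono[of j "max j k"] mono[of k "max j k"] by (intro exI[of _ "max j k"]) auto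
  qed auto
  then obtain k where "set (snd (g d)) \<subseteq> C k"
    using g[OF \<open>d \<in> E\<close>] d by metis
  then have "d \<in> grow (C k)"
    using \<open>d \<in> E\<close> unfolding grow_def
    by (intro UnI2 UN_I[of "g d"] UN_I[of d]) (auto simp: mem_Times_iff)
  then have "d \<in> V d"
    using d(2) C_Suc by blast
  then show False
    using V_irrefl by blast
qed

end

section \<open>Points and condensation points of the real line\<close>

text \<open>
  The topology of the real line has a countable base, so the basic sets that pull back to countable
  sets remove only countably many points altogether; every other point is a condensation point.
\<close>

lemma countable_non_condensation:
  fixes c :: "'a \<Rightarrow> real"
  shows "countable {a \<in> A. \<exists>e>0. countable {b \<in> A. \<bar>c b - c a\<bar> < e}}"
proof -
  obtain B :: "real set set" where B: "countable B" "topological_basis B"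
    using ex_countable_basis by blast
  let ?I = "{U \<in> B. countable {b \<in> A. c b \<in> U}}"
  have "countable (\<Union>U\<in>?I. {b \<in> A. c b \<in> U})"
    using B by (intro countable_UN) auto
  moreover have "{a \<in> A. \<exists>e>0. countable {b \<in> A. \<bar>c b - c a\<bar> < e}} \<subseteq> (\<Union>U\<in>?I. {b \<in> A. c b \<in> U})"
  proof -
    have "a \<in> (\<Union>U\<in>?I. {b \<in> A. c b \<in> U})" if a: "a \<in> A" "e > 0" "countable {b \<in> A. \<bar>c b - c a\<bar> < e}" for a e
  proof -
    obtain U where U: "U \<in> B" "c a \<in> U" "U \<subseteq> ball (c a) e"
      using topological_basisE[OF B(2) open_ball, of "c a" "c a" e] a by auto
    then have "{b \<in> A. c b \<in> U} \<subseteq> {b \<in> A. \<bar>c b - c a\<bar> < e}"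
      by (force simp: dist_real_def)
    then show ?thesis
      using U a countable_subset by blast
  qed
  then show ?thesis by blast
  qed
  ultimately show ?thesis
    by (metis (no_types, lifting) countable_subset)
qed

text \<open>
  \<open>\<aleph>\<^sub>1\<close> is the least cardinal above \<open>\<aleph>\<^sub>0\<close>, hence at most the
  cardinality of the continuum.
\<close>

lemma aleph1_inj_real:
  assumes "|D| =o cardSuc natLeq"
  obtains c :: "'a \<Rightarrow> real" where "inj_on c D"
proof -
  have "natLeq =o |UNIV :: nat set|"
    using card_of_nat ordIso_symmetric by blast
  then have "natLeq <o |UNIV :: nat set set|"
    using card_of_Pow[of "UNIV :: nat set"] by (simp add: ordIso_ordLess_trans)
  then have "|D| \<le>o |UNIV :: nat set set|"
    using assms cardSuc_least[OF natLeq_Card_order card_of_Card_order] ordIso_ordLeq_trans by blast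
  then obtain f :: "'a \<Rightarrow> nat set" where f: "inj_on f D"
    by (auto simp flip: card_of_ordLeq)
  obtain h :: "nat set \<Rightarrow> real" where "inj h"
    using nat_sets_eqpoll_reals by (auto simp: eqpoll_def bij_betw_def)
  then have "inj_on (h \<circ> f) D"
    using f by (simp add: comp_inj_on inj_on_subset)
  then show thesis by (rule that)
qed

section \<open>Metrics given by a weight function\<close>

text \<open>
  For positive \<open>w\<close> this is an ultrametric with \<open>w a\<close> as a lower bound for the distances from \<open>a\<close>
  to other points, so every point is isolated.
  The value \<open>0\<close> off \<open>D\<close> is the normalisation that membership in \<open>Met\<close> demands.
\<close>

definition max_metric :: "'a set \<Rightarrow> ('a \<Rightarrow> real) \<Rightarrow> 'a \<Rightarrow> 'a \<Rightarrow> real" where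
  "max_metric D w a b = (if a \<in> D \<and> b \<in> D \<and> a \<noteq> b then max (w a) (w b) else 0)"

lemma max_metric_in_Met:
  assumes w: "\<And>a. a \<in> D \<Longrightarrow> 0 < w a"
  shows "max_metric D w \<in> Met (discrete_topology D)"
proof -
  interpret Metric_space D "max_metric D w"
  proof
    show "0 \<le> max_metric D w a b" for a b
      using w[of a] by (auto simp: max_metric_def)
    show "max_metric D w a b = max_metric D w b a" for a b
      by (auto simp: max_metric_def)
    show "max_metric D w a b = 0 \<longleftrightarrow> a = b" if "a \<in> D" "b \<in> D" for a b
      using that w[of a] by (auto simp: max_metric_def max_def split: if_splits)
    show "max_metric D w a b \<le> max_metric D w a e + max_metric D w e b"
      if "a \<in> D" "e \<in> D" "b \<in> D" for a e b
      using that w[of a] w[of b] w[of e] by (auto simp: max_metric_def)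
  qed
  have "mtopology = discrete_topology D"
  proof (rule discrete_topology_unique[THEN iffD2, symmetric], intro conjI ballI)
    fix a assume a: "a \<in> D"
    have "mball a (w a) = {a}"
      using a w[of a] by (auto simp: max_metric_def split: if_splits)
    then show "openin mtopology {a}"
      by (metis openin_mball)
  qed simp
  then show ?thesis
    by (auto simp: Met_def Metric_space_axioms max_metric_def)
qed

text \<open>
  A vanishing weight at \<open>a\<close> need not destroy discreteness, since the distance from \<open>a\<close> to \<open>b\<close> may still
  be bounded below by \<open>w b\<close>. It does so as soon as other points have arbitrarily small weight, which makes \<open>a\<close> a limit
  of them.
\<close>

lemma max_metric_notin_Met:
  assumes "a \<in> D" "w a \<le> 0" and near: "\<And>e. e > 0 \<Longrightarrow> \<exists>b\<in>D. b \<noteq> a \<and> w b < e"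
  shows "max_metric D w \<notin> Met (discrete_topology D)"
proof
  assume "max_metric D w \<in> Met (discrete_topology D)"
  then have M: "Metric_space D (max_metric D w)"
    and top: "Metric_space.mtopology D (max_metric D w) = discrete_topology D"
    by (auto simp: Met_def)
  interpret Metric_space D "max_metric D w" by (rule M)
  have "openin mtopology {a}"
    using assms(1) by (simp add: top)
  then obtain e where e: "e > 0" "mball a e \<subseteq> {a}"
    by (auto simp: openin_mtopology)
  obtain b where "b \<in> D" "b \<noteq> a" "w b < e"
    using near e by blast
  then have "b \<in> mball a e"
    using e assms(1,2) by (auto simp: max_metric_def)
  with e \<open>b \<noteq> a\<close> show False by blast
qed

lemma max_metric_diff:
  assumes "\<And>a. a \<in> D \<Longrightarrow> \<bar>w a - w' a\<bar> \<le> e" "0 \<le> e"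
  shows "\<bar>max_metric D w a b - max_metric D w' a b\<bar> \<le> e"
  using assms(1)[of a] assms(1)[of b] assms(2) by (auto simp: max_metric_def)

section \<open>Preimages of the space of metrics\<close>

lemma continuous_map_Met_eval:
  assumes "a \<in> topspace X" "b \<in> topspace X"
  shows "continuous_map (Met_topology X) euclideanreal (\<lambda>d. d a b)"
proof -
  interpret M: Metric_space "Met X" "\<lambda>d d'. enn2real (min (sup_dist (topspace X) d d') 1)"
    by (rule Metric_space_Met)
  have "\<exists>U. openin M.mtopology U \<and> d \<in> U \<and> (\<forall>d'\<in>U. d' a b \<in> Met_TC.mball (d a b) e)"
    if d: "d \<in> Met X" and e: "e > 0" for d e
  proof (intro exI conjI ballI)
    show "openin M.mtopology (M.mball d (min e 1))" "d \<in> M.mball d (min e 1)"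
      using d e by auto
    fix d' assume "d' \<in> M.mball d (min e 1)"
    then have "enn2real (min (sup_dist (topspace X) d d') 1) < min e 1"
      by simp
    moreover have "min \<bar>d a b - d' a b\<bar> 1 \<le> enn2real (min (sup_dist (topspace X) d d') 1)"
    proof -
      have "ennreal (min \<bar>d a b - d' a b\<bar> 1) \<le> ennreal \<bar>d a b - d' a b\<bar>"
        by (rule ennreal_leI) simp
      also have "\<dots> \<le> sup_dist (topspace X) d d'"
        by (rule sup_dist_upper[OF assms])
      finally have "ennreal (min \<bar>d a b - d' a b\<bar> 1) \<le> sup_dist (topspace X) d d'" .
      moreover have "ennreal (min \<bar>d a b - d' a b\<bar> 1) \<le> 1"
        by (simp flip: ennreal_1 add: ennreal_leI)
      ultimately have "ennreal (min \<bar>d a b - d' a b\<bar> 1) \<le> min (sup_dist (topspace X) d d') 1"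
        by (rule min.boundedI)
      then have "enn2real (ennreal (min \<bar>d a b - d' a b\<bar> 1))
          \<le> enn2real (min (sup_dist (topspace X) d d') 1)"
        by (rule enn2real_mono) (simp add: min_less_iff_disj)
      then show ?thesis
        by (subst (asm) enn2real_ennreal) auto
    qed
    ultimately have "min \<bar>d a b - d' a b\<bar> 1 < min e 1" by linarith
    then show "d' a b \<in> Met_TC.mball (d a b) e"
      by (auto simp: dist_real_def)
  qed
  then show ?thesis
    unfolding Met_topology_def
    using Met_TC.continuous_map_to_metric[of M.mtopology "\<lambda>d. d a b"] by simp
qed

lemma continuous_map_into_Met:
  assumes "\<And>z. z \<in> topspace Z \<Longrightarrow> f z \<in> Met X"
    and near: "\<And>z e. z \<in> topspace Z \<Longrightarrow> 0 < e \<Longrightarrow>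
      \<exists>U. openin Z U \<and> z \<in> U \<and> (\<forall>z'\<in>U. \<forall>a\<in>topspace X. \<forall>b\<in>topspace X. \<bar>f z a b - f z' a b\<bar> \<le> e)"
  shows "continuous_map Z (Met_topology X) f"
proof -
  interpret M: Metric_space "Met X" "\<lambda>d d'. enn2real (min (sup_dist (topspace X) d d') 1)"
    by (rule Metric_space_Met)
  have "\<exists>U. openin Z U \<and> z \<in> U \<and> (\<forall>z'\<in>U. f z' \<in> M.mball (f z) e)"
    if z: "z \<in> topspace Z" and e: "e > 0" for z e
  proof -
    obtain U where U: "openin Z U" "z \<in> U"
      "\<And>z' a b. z' \<in> U \<Longrightarrow> a \<in> topspace X \<Longrightarrow> b \<in> topspace X \<Longrightarrow> \<bar>f z a b - f z' a b\<bar> \<le> e / 2"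
      using near[OF z, of "e / 2"] e by (auto simp: Ball_def)
    have "f z' \<in> M.mball (f z) e" if z': "z' \<in> U" for z'
    proof -
      have "sup_dist (topspace X) (f z) (f z') \<le> ennreal (e / 2)"
        unfolding sup_dist_def using U(3)[OF z'] by (auto intro!: SUP_least ennreal_leI)
      then have "enn2real (min (sup_dist (topspace X) (f z) (f z')) 1) \<le> e / 2"
        using e by (intro enn2real_leI) (auto intro: min.coboundedI1)
      then show ?thesis
        using z z' e U(1) assms(1) openin_subset by fastforce
    qed
    with U show ?thesis by blast
  qed
  then show ?thesis
    unfolding Met_topology_def M.continuous_map_to_metric by blast
qed

text \<open>
  Complete metrizability of the space of metrics passes to the parameters \<open>z\<close> whose weight gives an
  admissible metric. This set need not be closed in \<open>Z\<close>, but the map that it parametrises has a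
  closed graph in the product of \<open>Z\<close> with the space of metrics: if the metric \<open>d\<close> agrees pointwise
  with \<open>max_metric D (w z)\<close>, then \<open>z\<close> is admissible. A closed subspace of a completely metrizable
  space is completely metrizable, the projection of the graph to \<open>Z\<close> is a homeomorphism onto its
  image, and Lavrentiev's theorem turns this into a \<open>G\<^sub>\<delta>\<close> set.
\<close>

lemma gdelta_in_preimage_Met:
  assumes Z: "completely_metrizable_space Z"
    and Met: "completely_metrizable_space (Met_topology (discrete_topology D))"
    and w: "\<And>z e. z \<in> topspace Z \<Longrightarrow> 0 < e \<Longrightarrow>
      \<exists>U. openin Z U \<and> z \<in> U \<and> (\<forall>z'\<in>U. \<forall>a\<in>D. \<bar>w z a - w z' a\<bar> \<le> e)"
  shows "gdelta_in Z {z \<in> topspace Z. max_metric D (w z) \<in> Met (discrete_topology D)}"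
    (is "gdelta_in Z ?G")
proof -
  let ?Met = "Met_topology (discrete_topology D)" and ?f = "\<lambda>z. max_metric D (w z)"
  have topMet: "topspace ?Met = Met (discrete_topology D)"
    using Metric_space.topspace_mtopology[OF Metric_space_Met]
    unfolding Met_topology_def by blast
  have G: "?G \<subseteq> topspace Z" by blast
  have near: "\<exists>U. openin Z U \<and> z \<in> U \<and> (\<forall>z'\<in>U. \<forall>a b. \<bar>?f z a b - ?f z' a b\<bar> \<le> e)"
    if "z \<in> topspace Z" "0 < e" for z e
    using w[OF that] that max_metric_diff[of D "w z" _ e] by (metis less_imp_le)
  have "continuous_map (subtopology Z ?G) ?Met ?f"
  proof (rule continuous_map_into_Met)
    fix z and e :: real assume z: "z \<in> topspace (subtopology Z ?G)" and "0 < e"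
    then obtain U where U: "openin Z U" "z \<in> U" "\<forall>z'\<in>U. \<forall>a b. \<bar>?f z a b - ?f z' a b\<bar> \<le> e"
      using near[of z e] by auto
    have "openin (subtopology Z ?G) (U \<inter> ?G)"
      using U(1) by (auto simp: openin_subtopology)
    then show "\<exists>U. openin (subtopology Z ?G) U \<and> z \<in> U \<and> (\<forall>z'\<in>U.
        \<forall>a\<in>topspace (discrete_topology D). \<forall>b\<in>topspace (discrete_topology D).
          \<bar>?f z a b - ?f z' a b\<bar> \<le> e)"
      using U z by (intro exI[of _ "U \<inter> ?G"]) auto
  qed simp
  then have "(subtopology Z ?G) homeomorphic_space
      subtopology (prod_topology (subtopology Z ?G) ?Met) ((\<lambda>z. (z, ?f z)) ` ?G)"
    using homeomorphic_maps_graph[of "subtopology Z ?G" ?Met ?f]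
    unfolding topspace_subtopology_subset[OF G] homeomorphic_space_def by blast
  also have "subtopology (prod_topology (subtopology Z ?G) ?Met) ((\<lambda>z. (z, ?f z)) ` ?G)
      = subtopology (prod_topology Z ?Met) ((\<lambda>z. (z, ?f z)) ` ?G)"
    unfolding prod_topology_subtopology(1) subtopology_subtopology
    by (rule arg_cong[of _ _ "subtopology _"]) (auto simp: topMet)
  \<comment> \<open>Inserting the whole space keeps the family of closed sets nonempty when \<open>D\<close> is empty.\<close>
  also have "(\<lambda>z. (z, ?f z)) ` ?G
      = \<Inter>(insert (topspace (prod_topology Z ?Met))
          ((\<lambda>(a, b). {p \<in> topspace (prod_topology Z ?Met). ?f (fst p) a b = snd p a b}) ` (D \<times> D)))"
    (is "?L = ?R")
  proof
    show "?L \<subseteq> ?R" by (auto simp: topMet)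
    show "?R \<subseteq> ?L"
    proof
      fix p assume p: "p \<in> ?R"
      obtain z d where zd: "p = (z, d)" by fastforce
      have d: "d \<in> Met (discrete_topology D)" and z: "z \<in> topspace Z"
        using p by (auto simp: zd topMet)
      have "?f z a b = d a b" for a b
      proof (cases "a \<in> D \<and> b \<in> D")
        case True
        then have "(z, d) \<in> {p \<in> topspace (prod_topology Z ?Met). ?f (fst p) a b = snd p a b}"
          using p zd by blast
        then show ?thesis by simp
      next
        case False
        then show ?thesis using d by (auto simp: Met_def max_metric_def)
      qed
      then have "?f z = d" by blast
      then show "p \<in> ?L" using z d zd by auto
    qed
  qed
  finally have hom: "(subtopology Z ?G) homeomorphic_space subtopology (prod_topology Z ?Met) ?R" .
  have "closedin (prod_topology Z ?Met) {p \<in> topspace (prod_topology Z ?Met). ?f (fst p) a b = snd p a b}"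
    if ab: "a \<in> D" "b \<in> D" for a b
  proof (rule closedin_continuous_maps_eq[of euclideanreal])
    have "continuous_map Z euclideanreal (\<lambda>z. ?f z a b)"
    proof -
      have "\<exists>U. openin Z U \<and> z \<in> U \<and> (\<forall>z'\<in>U. ?f z' a b \<in> Met_TC.mball (?f z a b) e)"
        if z: "z \<in> topspace Z" "e > 0" for z e
      proof -
        obtain U where U: "openin Z U" "z \<in> U" "\<forall>z'\<in>U. \<forall>a b. \<bar>?f z a b - ?f z' a b\<bar> \<le> e / 2"
          using near[of z "e / 2"] z by auto
        have "?f z' a b \<in> Met_TC.mball (?f z a b) e" if "z' \<in> U" for z'
          using U(3)[rule_format, OF that, of a b] z(2) by (simp add: dist_real_def)
        with U show ?thesis by blast
      qed
      then show ?thesis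
        using Met_TC.continuous_map_to_metric[of Z "\<lambda>z. ?f z a b"] by simp
    qed
    then show "continuous_map (prod_topology Z ?Met) euclideanreal (\<lambda>p. ?f (fst p) a b)"
      using continuous_map_compose[OF continuous_map_fst] by (fastforce simp: o_def)
    show "continuous_map (prod_topology Z ?Met) euclideanreal (\<lambda>p. snd p a b)"
      using continuous_map_compose[OF continuous_map_snd continuous_map_Met_eval, of a "discrete_topology D" b Z] ab
      by (simp add: o_def)
  qed auto
  then have "closedin (prod_topology Z ?Met) ?R"
    by (intro closedin_Inter) (auto simp del: topspace_prod_topology)
  then have "completely_metrizable_space (subtopology (prod_topology Z ?Met) ?R)"
    using Z Met by (intro completely_metrizable_space_closedin)
      (auto simp: completely_metrizable_space_prod_topology)
  then have "completely_metrizable_space (subtopology Z ?G)"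
    using hom homeomorphic_completely_metrizable_space by blast
  then show ?thesis
    using Z G completely_metrizable_space_eq_gdelta_in by blast
qed

section \<open>Sequences with a real coordinate\<close>

text \<open>
  Measures how early the sequence leaves \<open>V\<close>. It plays the part of the distance from \<open>x\<close> to the
  closed set of sequences in \<open>V\<close>, for the metric of first difference.
\<close>

definition exit_rate :: "'a set \<Rightarrow> (nat \<Rightarrow> 'a) \<Rightarrow> real" where
  "exit_rate V x = (if range x \<subseteq> V then 0 else 1 / real (Suc (LEAST n. x n \<notin> V)))"

lemma exit_rate_pos_iff: "0 < exit_rate V x \<longleftrightarrow> \<not> range x \<subseteq> V"
  by (simp add: exit_rate_def)

lemma exit_rate_nonneg: "0 \<le> exit_rate V x"
  by (simp add: exit_rate_def)

text \<open>
  The bound does not depend on \<open>V\<close>, which is what makes the weights below equicontinuous over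
  all points of \<open>D\<close> and thus continuous for the supremum distance: either both sequences leave \<open>V\<close> at
  the same time before \<open>N\<close>, or both rates are small.
\<close>

lemma exit_rate_diff:
  assumes eq: "\<And>n. n < N \<Longrightarrow> x n = y n"
  shows "\<bar>exit_rate V x - exit_rate V y\<bar> \<le> 1 / real (Suc N)"
proof (cases "\<exists>n<N. x n \<notin> V")
  case True
  then obtain n where n: "n < N" "x n \<notin> V" by blast
  have "(LEAST n. x n \<notin> V) = (LEAST n. y n \<notin> V)"
  proof (rule Least_equality[symmetric])
    have "(LEAST n. x n \<notin> V) \<le> n"
      using n by (intro Least_le)
    then show "y (LEAST n. x n \<notin> V) \<notin> V"
      using eq n LeastI[of "\<lambda>n. x n \<notin> V" n] by (metis le_less_trans)
    show "(LEAST n. x n \<notin> V) \<le> m" if "y m \<notin> V" for m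
    proof (cases "m < N")
      case True
      then show ?thesis using eq that by (intro Least_le) simp
    next
      case False
      then show ?thesis using n \<open>(LEAST n. x n \<notin> V) \<le> n\<close> by simp
    qed
  qed
  moreover have "\<not> range x \<subseteq> V" "\<not> range y \<subseteq> V"
    using n eq[of n] by (metis rangeI subsetD)+
  ultimately have "exit_rate V x = exit_rate V y"
    by (simp add: exit_rate_def)
  then show ?thesis by simp
next
  case False
  have small: "exit_rate V z \<le> 1 / real (Suc N)" if "\<And>n. n < N \<Longrightarrow> z n \<in> V" for z
  proof (cases "range z \<subseteq> V")
    case True
    then show ?thesis by (simp add: exit_rate_def)
  next
    case z: False
    then have "z (LEAST n. z n \<notin> V) \<notin> V"
      using LeastI_ex[of "\<lambda>n. z n \<notin> V"] by blast
    then have "N \<le> (LEAST n. z n \<notin> V)"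
      using that not_less by blast
    then show ?thesis
      using z by (simp add: exit_rate_def frac_le)
  qed
  have "exit_rate V x \<le> 1 / real (Suc N)" "exit_rate V y \<le> 1 / real (Suc N)"
    using False eq by (intro small; force)+
  with exit_rate_nonneg[of V x] exit_rate_nonneg[of V y] show ?thesis
    by linarith
qed

abbreviation seq_real_space :: "'a set \<Rightarrow> ((nat \<Rightarrow> 'a) \<times> real) topology" where
  "seq_real_space D \<equiv> prod_topology (product_topology (\<lambda>_. discrete_topology D) UNIV) euclideanreal"

lemma openin_cylinder:
  assumes "x \<in> UNIV \<rightarrow> D"
  shows "openin (seq_real_space D)
    ({x'. range x' \<subseteq> D \<and> (\<forall>n<N. x' n = x n)} \<times> ball y e)"
proof -
  have "{x'. range x' \<subseteq> D \<and> (\<forall>n<N. x' n = x n)} = PiE UNIV (\<lambda>n. if n < N then {x n} else D)"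
    using assms by (fastforce simp: PiE_iff Pi_iff split: if_splits)
  moreover have "openin (product_topology (\<lambda>_. discrete_topology D) UNIV)
      (PiE UNIV (\<lambda>n. if n < N then {x n} else D))"
    using assms by (intro product_topology_basis)
      (auto intro: finite_subset[of _ "{..<N}"] simp: Pi_iff)
  ultimately show ?thesis
    by (intro openin_prod_Times_iff[THEN iffD2]) auto
qed

lemma openin_contains_cylinder:
  assumes "openin (seq_real_space D) U" "(x, y) \<in> U"
  shows "\<exists>N e. 0 < e \<and>
    (\<forall>x' y'. range x' \<subseteq> D \<and> (\<forall>n<N. x' n = x n) \<and> \<bar>y' - y\<bar> < e \<longrightarrow> (x', y') \<in> U)"
proof -
  obtain A B where AB: "openin (product_topology (\<lambda>_. discrete_topology D) UNIV) A" "open B"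
    "x \<in> A" "y \<in> B" "A \<times> B \<subseteq> U"
    using assms unfolding openin_prod_topology_alt by (metis open_openin)
  obtain X where X: "x \<in> PiE UNIV X" "finite {i. X i \<noteq> D}" "PiE UNIV X \<subseteq> A"
    using product_topology_open_contains_basis[OF AB(1,3)] by auto
  obtain N where N: "{i. X i \<noteq> D} \<subseteq> {..<N}"
    using X(2) finite_nat_iff_bounded by blast
  obtain e where e: "e > 0" "ball y e \<subseteq> B"
    using AB by (meson open_contains_ball)
  have "(x', y') \<in> U"
    if x': "range x' \<subseteq> D" "\<forall>n<N. x' n = x n" and y': "\<bar>y' - y\<bar> < e" for x' y'
  proof -
    have "x' n \<in> X n" for n
      using x' N X(1) by (cases "n < N") (auto simp: PiE_iff)
    then have "x' \<in> A" using X(3) by auto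
    moreover have "y' \<in> B"
      using y' e by (auto simp: dist_real_def)
    ultimately show ?thesis using AB by blast
  qed
  with e(1) show ?thesis by blast
qed

lemma completely_metrizable_seq_real_space: "completely_metrizable_space (seq_real_space D)"
  by (simp add: completely_metrizable_space_prod_topology completely_metrizable_space_product_topology
      completely_metrizable_space_discrete_topology completely_metrizable_space_euclidean)

context omega1_segments
begin

section \<open>The sets of degenerate parameters\<close>

text \<open>
  In the maximum metric of the product this is the distance of \<open>z\<close> from the closed set
  \<open>(V a)\<^sup>\<omega> \<times> {c a}\<close> if \<open>V a\<close> is nonempty. It vanishes exactly on that set.
\<close>

definition weight :: "('a \<Rightarrow> real) \<Rightarrow> (nat \<Rightarrow> 'a) \<times> real \<Rightarrow> 'a \<Rightarrow> real" where
  "weight c z a = max (exit_rate (V a) (fst z)) \<bar>snd z - c a\<bar>"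

lemma weight_equicontinuous:
  assumes z: "z \<in> topspace (seq_real_space D)" and e: "0 < e"
  shows "\<exists>U. openin (seq_real_space D) U \<and> z \<in> U \<and> (\<forall>z'\<in>U. \<forall>a\<in>D. \<bar>weight c z a - weight c z' a\<bar> \<le> e)"
proof -
  obtain x y where xy: "z = (x, y)" by fastforce
  have x: "x \<in> UNIV \<rightarrow> D" using z by (auto simp: xy)
  obtain N where N: "1 / real (Suc N) < e"
    using e by (metis nat_approx_posE)
  have max_diff: "\<bar>max p q - max p' q'\<bar> \<le> e" if "\<bar>p - p'\<bar> \<le> e" "\<bar>q - q'\<bar> \<le> e" for p q p' q'
  proof -
    have *: "max r s \<le> max r' s' + e" if "r \<le> r' + e" "s \<le> s' + e" for r s r' s'
      using that by (simp add: max.coboundedI1 max.coboundedI2 max_def)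
    have "max p q \<le> max p' q' + e" "max p' q' \<le> max p q + e"
      by (rule *; use that in linarith)+
    then show ?thesis by linarith
  qed
  let ?U = "{x'. range x' \<subseteq> D \<and> (\<forall>n<N. x' n = x n)} \<times> ball y e"
  have diff: "\<bar>weight c z a - weight c (x', y') a\<bar> \<le> e"
    if x': "\<And>n. n < N \<Longrightarrow> x n = x' n" and y': "\<bar>y - y'\<bar> < e" for x' y' a
  proof -
    have "\<bar>exit_rate (V a) x - exit_rate (V a) x'\<bar> \<le> e"
      using exit_rate_diff[of N x x' "V a", OF x'] N by linarith
    moreover have "\<bar>\<bar>y - c a\<bar> - \<bar>y' - c a\<bar>\<bar> \<le> e"
      using y' by linarith
    ultimately show ?thesis
      unfolding weight_def xy fst_conv snd_conv by (rule max_diff)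
  qed
  show ?thesis
  proof (intro exI conjI)
    show "openin (seq_real_space D) ?U" by (rule openin_cylinder[OF x])
    show "z \<in> ?U" unfolding xy using x e by (simp add: Pi_iff image_subset_iff)
    show "\<forall>z'\<in>?U. \<forall>a\<in>D. \<bar>weight c z a - weight c z' a\<bar> \<le> e"
    proof (intro ballI)
      fix z' a assume "z' \<in> ?U"
      then obtain x' y' where z': "z' = (x', y')" "\<forall>n<N. x' n = x n" "dist y y' < e"
        by auto
      show "\<bar>weight c z a - weight c z' a\<bar> \<le> e"
        unfolding z'(1) by (rule diff) (use z'(2,3) in \<open>simp_all add: dist_real_def\<close>)
    qed
  qed
qed

text \<open>
  Baire's theorem in the completely metrizable set \<open>(V a)\<^sup>\<omega> \<times> {t}\<close>: one of countably many closed sets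
  that cover it contains a relatively open piece, given by a finite initial sequence. That sequence
  lies in \<open>V a\<close>, so the choice of it is regressive in \<open>a\<close>.
\<close>

lemma cylinder_in_cover:
  assumes a: "a \<in> D" "V a \<noteq> {}"
    and F: "\<And>n. closedin (seq_real_space D) (F n)"
    and cover: "\<And>x. range x \<subseteq> V a \<Longrightarrow> (x, t) \<in> (\<Union>n. F n)"
  shows "\<exists>(n::nat) s. set s \<subseteq> V a \<and>
    (\<forall>x. range x \<subseteq> V a \<and> (\<forall>i<length s. x i = s ! i) \<longrightarrow> (x, t) \<in> F n)"
proof -
  let ?Z = "seq_real_space D" and ?B = "{x. range x \<subseteq> V a} \<times> {t}"
  have VD: "V a \<subseteq> D" using V_subset a by blast
  have B_eq: "?B = PiE UNIV (\<lambda>_. V a) \<times> {t}"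
    by (auto simp: PiE_iff)
  have B_closed: "closedin ?Z ?B"
    unfolding B_eq closedin_prod_Times_iff closedin_product_topology using VD by auto
  have top: "topspace (subtopology ?Z ?B) = ?B"
    using closedin_subset[OF B_closed] by (rule topspace_subtopology_subset)
  have "\<exists>n. subtopology ?Z ?B interior_of (F n \<inter> ?B) \<noteq> {}"
  proof (rule ccontr)
    assume "\<not> ?thesis"
    moreover have "closedin (subtopology ?Z ?B) (F n \<inter> ?B)" for n
      using F by (auto simp: closedin_subtopology)
    ultimately have "subtopology ?Z ?B interior_of \<Union>(range (\<lambda>n. F n \<inter> ?B)) = {}"
      using completely_metrizable_space_closedin[OF completely_metrizable_seq_real_space B_closed]
      by (intro Baire_category_alt) auto
    moreover have "\<Union>(range (\<lambda>n. F n \<inter> ?B)) = topspace (subtopology ?Z ?B)"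
      unfolding top using cover by auto
    moreover have "?B \<noteq> {}" using a by auto
    ultimately show False
      using top by (metis interior_of_topspace)
  qed
  then obtain n x0 where "x0 \<in> subtopology ?Z ?B interior_of (F n \<inter> ?B)" by blast
  then obtain W where W: "openin (subtopology ?Z ?B) W" "x0 \<in> W" "W \<subseteq> F n \<inter> ?B"
    by (auto simp: interior_of_def)
  then obtain U where U: "openin ?Z U" "W = U \<inter> ?B"
    by (auto simp: openin_subtopology)
  obtain x where x: "x0 = (x, t)" "range x \<subseteq> V a"
    using W U by auto
  have xU: "(x, t) \<in> U" using W U x by blast
  obtain N e where Ne: "0 < e"
    "\<forall>x' y'. range x' \<subseteq> D \<and> (\<forall>n<N. x' n = x n) \<and> \<bar>y' - t\<bar> < e \<longrightarrow> (x', y') \<in> U"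
    using openin_contains_cylinder[OF U(1) xU] by blast
  let ?s = "map x [0..<N]"
  show ?thesis
  proof (intro exI conjI allI impI)
    show "set ?s \<subseteq> V a" using x by auto
    fix x' assume x': "range x' \<subseteq> V a \<and> (\<forall>i<length ?s. x' i = ?s ! i)"
    then have "\<forall>n<N. x' n = x n" by simp
    then have "(x', t) \<in> U"
      using Ne x' VD by auto
    then show "(x', t) \<in> F n"
      using x' U W by auto
  qed
qed

text \<open>
  A putative \<open>F\<^sub>\<sigma>\<close> representation of the degenerate parameters is refuted by a good parameter that
  is a limit of degenerate ones from one and the same closed set.
\<close>

lemma not_completely_metrizable_Met:
  fixes c :: "'a \<Rightarrow> real"
  assumes c: "inj_on c D"
  shows "\<not> completely_metrizable_space (Met_topology (discrete_topology D))"
proof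
  assume Met: "completely_metrizable_space (Met_topology (discrete_topology D))"
  let ?Z = "seq_real_space D"
  let ?G = "{z \<in> topspace ?Z. max_metric D (weight c z) \<in> Met (discrete_topology D)}"
  have "gdelta_in ?Z ?G"
    by (rule gdelta_in_preimage_Met[where w = "weight c", OF completely_metrizable_seq_real_space Met
          weight_equicontinuous])
  then have "fsigma_in ?Z (topspace ?Z - ?G)"
    by (simp only: gdelta_in_fsigma_in)
  then obtain F :: "nat \<Rightarrow> _" where F: "\<And>n. closedin ?Z (F n)"
    and FG: "(\<Union>n. F n) = topspace ?Z - ?G"
    unfolding fsigma_in_ascending by metis
  have good: "(x, y) \<in> ?G"
    if "range x \<subseteq> D" "\<And>a. a \<in> D \<Longrightarrow> y = c a \<Longrightarrow> \<not> range x \<subseteq> V a" for x y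
  proof -
    have "0 < weight c (x, y) a" if "a \<in> D" for a
      using \<open>\<And>a. a \<in> D \<Longrightarrow> y = c a \<Longrightarrow> \<not> range x \<subseteq> V a\<close>[of a] that
        exit_rate_nonneg[of "V a" x] exit_rate_pos_iff[of "V a" x]
      by (auto simp: weight_def less_max_iff_disj)
    then show ?thesis
      using that(1) max_metric_in_Met[of D "weight c (x, y)"] by (auto simp: PiE_iff)
  qed

  \<comment> \<open>Outside \<open>T\<close> the real \<open>c a\<close> is a condensation point, so vanishing weight at \<open>a\<close> is degenerate.\<close>
  define T where "T = {a \<in> D. \<exists>e>0. countable {b \<in> D. \<bar>c b - c a\<bar> < e}}"
  obtain q where q: "q \<in> D"
    using uncountable_D by (metis countable_empty ex_in_conv)
  define E where "E = {a \<in> D. V a \<noteq> {}} - T"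
  have "countable (T \<union> {a \<in> D. q \<notin> V a})"
    unfolding T_def using countable_not_above[OF q] countable_non_condensation by blast
  moreover have "D - E \<subseteq> T \<union> {a \<in> D. q \<notin> V a}"
    unfolding E_def by auto
  ultimately have E: "E \<subseteq> D" "countable (D - E)"
    unfolding E_def by (blast, meson countable_subset)

  have bad: "(x, c a) \<in> (\<Union>n. F n)" if a: "a \<in> E" and x: "range x \<subseteq> V a" for a x
  proof -
    have aD: "a \<in> D" and xD: "range x \<subseteq> D" using a x E V_subset by blast+
    have "max_metric D (weight c (x, c a)) \<notin> Met (discrete_topology D)"
    proof (rule max_metric_notin_Met[OF aD])
      show "weight c (x, c a) a \<le> 0"
        using x by (simp add: weight_def exit_rate_def)
      fix e :: real assume "e > 0"
      then have unc: "uncountable {b \<in> D. \<bar>c b - c a\<bar> < e}"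
        using a unfolding E_def T_def by blast
      have "countable ({b \<in> D. a \<notin> V b})"
        by (rule countable_not_above[OF aD])
      then obtain b where b: "b \<in> D" "\<bar>c b - c a\<bar> < e" "a \<in> V b"
        using unc countable_subset[of "{b \<in> D. \<bar>c b - c a\<bar> < e}" "{b \<in> D. a \<notin> V b}"] by blast
      have "range x \<subseteq> V b"
        using x V_trans[OF b(3)] by blast
      then have "weight c (x, c a) b < e"
        using b \<open>e > 0\<close> by (simp add: weight_def exit_rate_def abs_minus_commute)
      moreover have "b \<noteq> a" using b(3) V_irrefl by blast
      ultimately show "\<exists>b\<in>D. b \<noteq> a \<and> weight c (x, c a) b < e"
        using b by blast
    qed
    then show ?thesis
      unfolding FG using xD by (auto simp: PiE_iff)
  qed

  have "\<exists>p. set (snd p) \<subseteq> V a \<and> (\<forall>x. range x \<subseteq> V a \<longrightarrow>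
      (\<forall>i<length (snd p). x i = snd p ! i) \<longrightarrow> (x, c a) \<in> F (fst p))" if a: "a \<in> E" for a
  proof -
    have "\<exists>n s. set s \<subseteq> V a \<and>
        (\<forall>x. range x \<subseteq> V a \<and> (\<forall>i<length s. x i = s ! i) \<longrightarrow> (x, c a) \<in> F n)"
    proof (rule cylinder_in_cover)
      show "a \<in> D" "V a \<noteq> {}" using a by (auto simp: E_def)
      show "closedin ?Z (F n)" for n by (rule F)
      show "(x, c a) \<in> (\<Union>n. F n)" if "range x \<subseteq> V a" for x
        by (rule bad[OF a that])
    qed
    then obtain n s where "set s \<subseteq> V a"
      "\<forall>x. range x \<subseteq> V a \<and> (\<forall>i<length s. x i = s ! i) \<longrightarrow> (x, c a) \<in> F n" by blast
    then show ?thesis by (intro exI[of _ "(n, s)"]) simp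
  qed
  then obtain g where g: "\<And>a. a \<in> E \<Longrightarrow> set (snd (g a)) \<subseteq> V a"
    "\<And>a x. a \<in> E \<Longrightarrow> range x \<subseteq> V a \<Longrightarrow> \<forall>i<length (snd (g a)). x i = snd (g a) ! i
      \<Longrightarrow> (x, c a) \<in> F (fst (g a))"
    by metis
  obtain p where p: "uncountable {a \<in> E. g a = p}"
    using pressing_down[OF g(1) E] by blast
  define A where "A = {a \<in> E. g a = p}"
  define n s where "n = fst p" and "s = snd p"
  have A: "A \<subseteq> E" "A \<subseteq> D" "uncountable A" using p E by (auto simp: A_def)
  have sD: "set s \<subseteq> D"
  proof -
    obtain a where "a \<in> A" using A(3) by (metis countable_empty ex_in_conv)
    then show ?thesis using g(1)[of a] V_subset[of a] A by (auto simp: A_def s_def)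
  qed
  obtain b where b: "b \<in> A" "\<And>e. e > 0 \<Longrightarrow> uncountable {a \<in> A. \<bar>c a - c b\<bar> < e}"
    using countable_non_condensation[of A c] A(3)
    by (metis (mono_tags, lifting) countable_subset mem_Collect_eq subsetI)
  \<comment> \<open>Reaching \<open>b\<close>, the sequence leaves \<open>V b\<close>; yet it stays in \<open>V a\<close> for all but countably many \<open>a\<close>.\<close>
  define x where "x i = (if i < length s then s ! i else b)" for i
  have ran: "range x \<subseteq> insert b (set s)" by (auto simp: x_def)
  have bD: "b \<in> D" using b A by blast
  have xD: "range x \<subseteq> D" using ran sD bD by blast
  have bx: "b \<in> range x" by (auto simp: x_def intro!: image_eqI[of _ _ "length s"])
  have "(x, c b) \<in> ?G"
  proof (rule good[OF xD])
    fix a assume "a \<in> D" "c b = c a"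
    then have "a = b" using c bD by (auto dest: inj_onD)
    then show "\<not> range x \<subseteq> V a" using bx V_irrefl by blast
  qed
  then have "(x, c b) \<in> topspace ?Z - F n"
    using FG by blast
  from openin_contains_cylinder[OF openin_diff[OF openin_topspace F[of n]] this]
  obtain N e where Ne: "0 < e" "\<forall>x' y'. range x' \<subseteq> D \<and> (\<forall>n<N. x' n = x n) \<and> \<bar>y' - c b\<bar> < e
      \<longrightarrow> (x', y') \<in> topspace ?Z - F n"
    by blast
  have cnt: "countable (\<Union>d\<in>insert b (set s). {a \<in> D. d \<notin> V a})"
    using countable_not_above sD bD
    by (intro countable_UN) (auto simp: countable_finite)
  have "\<not> {a \<in> A. \<bar>c a - c b\<bar> < e} \<subseteq> (\<Union>d\<in>insert b (set s). {a \<in> D. d \<notin> V a})"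
  proof
    assume "{a \<in> A. \<bar>c a - c b\<bar> < e} \<subseteq> (\<Union>d\<in>insert b (set s). {a \<in> D. d \<notin> V a})"
    from countable_subset[OF this cnt] b(2)[OF Ne(1)] show False by contradiction
  qed
  then obtain a where a: "a \<in> A" "\<bar>c a - c b\<bar> < e" "a \<notin> (\<Union>d\<in>insert b (set s). {a \<in> D. d \<notin> V a})"
    by blast
  then have "range x \<subseteq> V a"
    using ran A(2) by blast
  moreover have "\<forall>i<length s. x i = s ! i"
    by (simp add: x_def)
  ultimately have "(x, c a) \<in> F n"
    using g(2)[of a x] a(1) unfolding n_def s_def A_def by auto
  moreover have "(x, c a) \<notin> F n"
    using Ne(2) xD a by blast
  ultimately show False by blast
qed

end

theorem theorem4p2:
  fixes D :: "'a set"
  assumes "|D| =o cardSuc natLeq"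
  shows "\<not> completely_metrizable_space (Met_topology (discrete_topology D))"
proof -
  obtain V where "omega1_segments D V"
    using aleph1_omega1_segments[OF assms] .
  moreover obtain c :: "'a \<Rightarrow> real" where "inj_on c D"
    using aleph1_inj_real[OF assms] .
  ultimately show ?thesis
    by (rule omega1_segments.not_completely_metrizable_Met)
qed

end
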